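(* For every even integer $k \geq 4$, every integer $t \geq 3$ and every positive integer $s \equiv 0 \pmod{2t}$, the graph $C_k \times K_s$ has a $C_{kt}$-factorization.
   Context: $C_m$ denotes the cycle on $m$ vertices and $K_n$ the complete graph on $n$ vertices. For graphs $G,H$, the tensor product $G \times H$ has vertex set $V(G)\times V(H)$, with $(g_1,h_1)$ adjacent to $(g_2,h_2)$ iff $g_1g_2 \in E(G)$ and $h_1h_2 \in E(H)$. A $C_m$-factor of a graph is a spanning subgraph all of whose components are cycles of length $m$; a $C_m$-factorization is a partition of the edge set into $C_m$-factors. *)

theory Defs
  imports Main "HOL-Library.Disjoint_Sets" "HOL-Number_Theory.Cong"
begin

(* Simple undirected graphs; an edge is the two-element set of its endpoints. *)
record 'a graph =
  verts :: "'a set"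
  edges :: "'a set set"

definition graph_iso :: "('a \<Rightarrow> 'b) \<Rightarrow> 'a graph \<Rightarrow> 'b graph \<Rightarrow> bool" where
  "graph_iso f G H \<longleftrightarrow> bij_betw f (verts G) (verts H) \<and>
     (\<forall>u\<in>verts G. \<forall>v\<in>verts G. {u, v} \<in> edges G \<longleftrightarrow> {f u, f v} \<in> edges H)"

definition isomorphic :: "'a graph \<Rightarrow> 'b graph \<Rightarrow> bool" where
  "isomorphic G H \<longleftrightarrow> (\<exists>f. graph_iso f G H)"

(* This is the m-cycle only for m \<ge> 3; smaller m give degenerate edge sets. *)
definition cycle_graph :: "nat \<Rightarrow> nat graph" where
  "cycle_graph m = \<lparr>verts = {..<m}, edges = {{i, Suc i mod m} | i. i < m}\<rparr>"

definition complete_graph :: "nat \<Rightarrow> nat graph" where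
  "complete_graph n = \<lparr>verts = {..<n}, edges = {{i, j} | i j. i < n \<and> j < n \<and> i \<noteq> j}\<rparr>"

definition tensor_product :: "'a graph \<Rightarrow> 'b graph \<Rightarrow> ('a \<times> 'b) graph" where
  "tensor_product G H = \<lparr>verts = verts G \<times> verts H,
     edges = {{(g\<^sub>1, h\<^sub>1), (g\<^sub>2, h\<^sub>2)} | g\<^sub>1 h\<^sub>1 g\<^sub>2 h\<^sub>2. {g\<^sub>1, g\<^sub>2} \<in> edges G \<and> {h\<^sub>1, h\<^sub>2} \<in> edges H}\<rparr>"

lemma tensor_product_adj:
  "{(g\<^sub>1, h\<^sub>1), (g\<^sub>2, h\<^sub>2)} \<in> edges (tensor_product G H) \<longleftrightarrow>
     {g\<^sub>1, g\<^sub>2} \<in> edges G \<and> {h\<^sub>1, h\<^sub>2} \<in> edges H"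
  by (auto simp: tensor_product_def doubleton_eq_iff insert_commute)

definition spanning_subgraph :: "'a graph \<Rightarrow> 'a graph \<Rightarrow> bool" where
  "spanning_subgraph F G \<longleftrightarrow> verts F = verts G \<and> edges F \<subseteq> edges G"

definition induced_subgraph :: "'a graph \<Rightarrow> 'a set \<Rightarrow> 'a graph" where
  "induced_subgraph G S = \<lparr>verts = S, edges = {e \<in> edges G. e \<subseteq> S}\<rparr>"

definition components :: "'a graph \<Rightarrow> 'a graph set" where
  "components G =
     {induced_subgraph G {w \<in> verts G. (v, w) \<in> {(x, y). {x, y} \<in> edges G}\<^sup>*} | v. v \<in> verts G}"

definition cycle_factor :: "nat \<Rightarrow> 'a graph \<Rightarrow> 'a graph \<Rightarrow> bool" where
  "cycle_factor m G F \<longleftrightarrow>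
     spanning_subgraph F G \<and> (\<forall>C \<in> components F. isomorphic C (cycle_graph m))"

(* Distinct factors in the set have distinct edge sets, since they share the vertex set of G;
   so the members are pairwise edge-disjoint. *)
definition cycle_factorization :: "nat \<Rightarrow> 'a graph \<Rightarrow> 'a graph set \<Rightarrow> bool" where
  "cycle_factorization m G \<F> \<longleftrightarrow>
     (\<forall>F \<in> \<F>. cycle_factor m G F) \<and> partition_on (edges G) (edges ` \<F>)"

end

theory Submission
  imports Defs
begin

text \<open>Between two consecutive layers of \<open>C\<^sub>k \<times> K\<^sub>s\<close> lies a complete bipartite graph minus a perfect
  matching, so a Latin square with identity row splits it into \<open>s - 1\<close> perfect matchings
  \<open>\<sigma>\<^sub>j\<close>. Read every such matching from the even layer to the odd one; this is possible since
  \<open>k\<close> is even. The \<open>j\<close>-th factor uses \<open>\<sigma>\<^sub>j\<close> in all gaps except the last, where it uses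
  \<open>\<sigma>\<^bsub>\<pi>(j)\<^esub>\<close> for a permutation \<open>\<pi>\<close> of the indices. Walking once around the layers then cancels to
  \<open>\<sigma>\<^bsub>\<pi>(j)\<^esub>\<^sup>-\<^sup>1 \<circ> \<sigma>\<^sub>j\<close>, and the factor consists of \<open>kt\<close>-cycles as soon as all cycles of this permutation
  have length \<open>t\<close>. Such \<open>\<sigma>\<close> and \<open>\<pi>\<close> are obtained by pairing translations of
  \<open>\<int>\<^sub>t \<times> \<int>\<^sub>2 \<times> \<int>\<^sub>m\<close>, \<open>s = 2tm\<close>, that differ by a generator of \<open>\<int>\<^sub>t\<close>. For even \<open>t\<close> one
  nonzero translation remains unpaired, and a twist of the translations by \<open>(a, 1, 0)\<close> allows
  three of them to be permuted cyclically instead.\<close>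

section \<open>Cycle components\<close>

lemma cycle_graph_adj:
  assumes "p < m" "q < m"
  shows "{p, q} \<in> edges (cycle_graph m) \<longleftrightarrow> q = Suc p mod m \<or> p = Suc q mod m"
  using assms by (auto simp: cycle_graph_def doubleton_eq_iff)

lemma Suc_mod_cancel: "Suc a mod m = Suc b mod m \<longleftrightarrow> a mod m = b mod (m::nat)"
  using cong_add_rcancel_nat[of a 1 b m] by (simp add: cong_def)

text \<open>The neighbours of a walk vertex are again on the walk, so \<open>range f\<close> is a
  whole component, and the index modulo \<open>m\<close> is an isomorphism onto the cycle. Asking
  for the neighbours of \<open>f (Suc n)\<close> avoids a predecessor of index 0.\<close>

lemma component_of_periodic_walk:
  fixes f :: "nat \<Rightarrow> 'a"
  assumes m: "m > 0"
    and f_eq: "\<And>i j. f i = f j \<longleftrightarrow> i mod m = j mod m"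
    and nbr: "\<And>n w. {f (Suc n), w} \<in> edges F \<longleftrightarrow> w = f n \<or> w = f (Suc (Suc n))"
    and sub: "range f \<subseteq> verts F"
  shows "isomorphic (induced_subgraph F {w \<in> verts F. (f a, w) \<in> {(x, y). {x, y} \<in> edges F}\<^sup>*})
           (cycle_graph m)"
proof -
  let ?R = "{(x, y). {x, y} \<in> edges F}"
  \<comment> \<open>By periodicity \<open>n\<close> may be replaced by \<open>n + m\<close>, which
    is a successor.\<close>
  have shift: "\<exists>n'. f n = f (Suc n')" for n
    using m f_eq[of n "Suc (n + m - 1)"] by (intro exI[of _ "n + m - 1"]) simp
  have reach: "{w \<in> verts F. (f a, w) \<in> ?R\<^sup>*} = range f"
  proof (intro equalityI subsetI)
    fix w assume "w \<in> {w \<in> verts F. (f a, w) \<in> ?R\<^sup>*}"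
    then have "(f a, w) \<in> ?R\<^sup>*" by simp
    then show "w \<in> range f"
    proof (induction rule: rtrancl_induct)
      case base
      show ?case by simp
    next
      case (step y z)
      then obtain n where "y = f (Suc n)" using shift by blast
      with step.hyps nbr show ?case by auto
    qed
  next
    fix w assume "w \<in> range f"
    then obtain b where w: "w = f b" by blast
    have step: "(f n, f (Suc n)) \<in> ?R" for n
      using nbr[of n "f n"] by (simp add: insert_commute)
    have "(f a, f (a + i)) \<in> ?R\<^sup>*" for i
      by (induction i) (auto intro: rtrancl_into_rtrancl[OF _ step])
    \<comment> \<open>The walk is followed forwards only; since \<open>b\<close> may be smaller than
      \<open>a\<close>, the index \<open>b + m * a\<close> is aimed at instead.\<close>
    moreover have "f (a + (b + m * a - a)) = w"
    proof -
      have "a \<le> m * a" using m by simp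
      then have "a + (b + m * a - a) = b + m * a" by linarith
      then show ?thesis by (simp add: w f_eq)
    qed
    ultimately show "w \<in> {w \<in> verts F. (f a, w) \<in> ?R\<^sup>*}"
      using w sub by (metis (no_types, lifting) mem_Collect_eq rangeI subsetD)
  qed
  \<comment> \<open>The chosen index is arbitrary, but its residue modulo \<open>m\<close> depends
    on \<open>w\<close> alone.\<close>
  define g where "g = (\<lambda>w. (SOME n. f n = w) mod m)"
  have g: "g (f n) = n mod m" for n
    unfolding g_def using someI[of "\<lambda>i. f i = f n" n] by (simp add: f_eq)
  have "bij_betw g (range f) {..<m}"
  proof (rule bij_betwI')
    fix x y assume "x \<in> range f" "y \<in> range f"
    then show "(g x = g y) = (x = y)" by (auto simp: g f_eq)
  next
    fix x assume "x \<in> range f"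
    then show "g x \<in> {..<m}" using m by (auto simp: g)
  next
    fix y assume "y \<in> {..<m}"
    then show "\<exists>x\<in>range f. y = g x" by (intro bexI[of _ "f y"]) (auto simp: g)
  qed
  moreover have "{f i, f j} \<in> edges F \<longleftrightarrow> {g (f i), g (f j)} \<in> edges (cycle_graph m)" for i j
  proof -
    obtain n where n: "f i = f (Suc n)" using shift by blast
    have "{g (f i), g (f j)} \<in> edges (cycle_graph m) \<longleftrightarrow>
        j mod m = Suc (Suc n) mod m \<or> Suc n mod m = Suc j mod m"
      unfolding n g using m by (simp add: cycle_graph_adj mod_Suc_eq)
    then show ?thesis
      unfolding n nbr f_eq Suc_mod_cancel by auto
  qed
  ultimately show ?thesis
    unfolding reach isomorphic_def graph_iso_def
    by (intro exI[of _ g]) (auto simp: induced_subgraph_def cycle_graph_def)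
qed

lemma cycle_factorI:
  fixes F :: "'a graph"
  assumes "spanning_subgraph F G" and m: "m > 0"
    and walk: "\<And>v. v \<in> verts F \<Longrightarrow> \<exists>f::nat \<Rightarrow> 'a. v \<in> range f \<and> range f \<subseteq> verts F \<and>
       (\<forall>i j. f i = f j \<longleftrightarrow> i mod m = j mod m) \<and>
       (\<forall>n w. {f (Suc n), w} \<in> edges F \<longleftrightarrow> w = f n \<or> w = f (Suc (Suc n)))"
  shows "cycle_factor m G F"
  unfolding cycle_factor_def
proof (intro conjI ballI)
  fix C assume "C \<in> components F"
  then obtain v where v: "v \<in> verts F"
    and C: "C = induced_subgraph F {w \<in> verts F. (v, w) \<in> {(x, y). {x, y} \<in> edges F}\<^sup>*}"
    by (auto simp: components_def)
  from walk[OF v] obtain f :: "nat \<Rightarrow> 'a" and a where "v = f a" "range f \<subseteq> verts F"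
      "\<And>i j. f i = f j \<longleftrightarrow> i mod m = j mod m"
      "\<And>n w. {f (Suc n), w} \<in> edges F \<longleftrightarrow> w = f n \<or> w = f (Suc (Suc n))"
    by auto
  then show "isomorphic C (cycle_graph m)"
    unfolding C using component_of_periodic_walk[OF m, of f F a] by simp
qed (fact assms(1))


section \<open>Latin families of derangements\<close>

text \<open>The maps \<open>\<sigma> j\<close> are the non-identity rows of a Latin square on \<open>V\<close>, and the last clause
  says that every orbit of the permutation \<open>(\<sigma> (\<pi> j))\<^sup>-\<^sup>1 \<circ> \<sigma> j\<close> has exactly \<open>t\<close> elements.\<close>

definition rotation_family ::
  "nat \<Rightarrow> 'v set \<Rightarrow> 'j set \<Rightarrow> ('j \<Rightarrow> 'v \<Rightarrow> 'v) \<Rightarrow> ('j \<Rightarrow> 'j) \<Rightarrow> bool" where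
  "rotation_family t V J \<sigma> \<pi> \<longleftrightarrow> bij_betw \<pi> J J \<and>
     (\<forall>j\<in>J. bij_betw (\<sigma> j) V V \<and> (\<forall>x\<in>V. \<sigma> j x \<noteq> x)) \<and>
     (\<forall>x\<in>V. \<forall>y\<in>V. x \<noteq> y \<longrightarrow> (\<exists>!j. j \<in> J \<and> \<sigma> j x = y)) \<and>
     (\<forall>j\<in>J. \<exists>\<rho>. \<forall>x\<in>V. \<rho> x \<in> V \<and> \<sigma> (\<pi> j) (\<rho> x) = \<sigma> j x \<and> (\<forall>n. (\<rho> ^^ n) x = x \<longleftrightarrow> t dvd n))"

text \<open>Every clause survives conjugation by \<open>h\<close>, with the maps
  \<open>\<rho>\<close> conjugated as well. This carries a family built on a group over to
  \<open>{..<s}\<close>.\<close>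

lemma rotation_family_transfer:
  assumes rf: "rotation_family t V J \<sigma> \<pi>" and h: "bij_betw h V W"
  shows "rotation_family t W J (\<lambda>j. h \<circ> \<sigma> j \<circ> inv_into V h) \<pi>"
proof -
  let ?h = "inv_into V h"
  have h': "bij_betw ?h W V" using bij_betw_inv_into[OF h] .
  have hV: "h x \<in> W" "?h (h x) = x" if "x \<in> V" for x
    using h that by (auto simp: bij_betw_def)
  have hW: "?h y \<in> V" "h (?h y) = y" if "y \<in> W" for y
    using h h' that bij_betw_inv_into_right[OF h] by (auto simp: bij_betw_def)
  have bij: "bij_betw (\<sigma> j) V V" and derange: "x \<in> V \<Longrightarrow> \<sigma> j x \<noteq> x" if "j \<in> J" for j x
    using rf that by (auto simp: rotation_family_def)
  have \<sigma>V: "\<sigma> j x \<in> V" if "j \<in> J" "x \<in> V" for j x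
    using bij[OF that(1)] that(2) by (auto simp: bij_betw_def)
  have \<sigma>h: "h (\<sigma> j x) = y \<longleftrightarrow> \<sigma> j x = ?h y" if "j \<in> J" "x \<in> V" "y \<in> W" for j x y
    using hV(2)[OF \<sigma>V[OF that(1,2)]] hW(2)[OF that(3)] by auto
  have 1: "bij_betw (h \<circ> \<sigma> j \<circ> ?h) W W" if "j \<in> J" for j
    using bij_betw_trans[OF bij_betw_trans[OF h' bij[OF that]] h] by (simp add: comp_assoc)
  have 2: "(h \<circ> \<sigma> j \<circ> ?h) x \<noteq> x" if "j \<in> J" "x \<in> W" for j x
    using that \<sigma>h hW derange by simp
  have 3: "\<exists>!j. j \<in> J \<and> (h \<circ> \<sigma> j \<circ> ?h) x = y" if "x \<in> W" "y \<in> W" "x \<noteq> y" for x y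
  proof -
    have "?h x \<noteq> ?h y" using that hW by metis
    then have "\<exists>!j. j \<in> J \<and> \<sigma> j (?h x) = ?h y"
      using rf that hW by (auto simp: rotation_family_def)
    moreover have "(j \<in> J \<and> (h \<circ> \<sigma> j \<circ> ?h) x = y) \<longleftrightarrow> (j \<in> J \<and> \<sigma> j (?h x) = ?h y)" for j
      using \<sigma>h[of j "?h x" y] that(1,2) hW by auto
    ultimately show ?thesis by presburger
  qed
  have 4: "\<exists>\<rho>. \<forall>x\<in>W. \<rho> x \<in> W \<and> (h \<circ> \<sigma> (\<pi> j) \<circ> ?h) (\<rho> x) = (h \<circ> \<sigma> j \<circ> ?h) x \<and>
      (\<forall>n. (\<rho> ^^ n) x = x \<longleftrightarrow> t dvd n)" if j: "j \<in> J" for j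
  proof -
    obtain \<rho> where \<rho>: "\<And>x. x \<in> V \<Longrightarrow> \<rho> x \<in> V" "\<And>x. x \<in> V \<Longrightarrow> \<sigma> (\<pi> j) (\<rho> x) = \<sigma> j x"
      "\<And>x n. x \<in> V \<Longrightarrow> (\<rho> ^^ n) x = x \<longleftrightarrow> t dvd n"
      using rf j unfolding rotation_family_def by metis
    have pow: "(\<rho> ^^ n) x \<in> V \<and> ((h \<circ> \<rho> \<circ> ?h) ^^ n) (h x) = h ((\<rho> ^^ n) x)" if "x \<in> V" for n x
      using that by (induction n) (auto simp: \<rho> hV)
    have "((h \<circ> \<rho> \<circ> ?h) ^^ n) y = y \<longleftrightarrow> t dvd n" if "y \<in> W" for n y
    proof -
      have "((h \<circ> \<rho> \<circ> ?h) ^^ n) y = h ((\<rho> ^^ n) (?h y))" and V: "(\<rho> ^^ n) (?h y) \<in> V"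
        using pow[of "?h y" n] hW[OF that] by auto
      then have "((h \<circ> \<rho> \<circ> ?h) ^^ n) y = y \<longleftrightarrow> (\<rho> ^^ n) (?h y) = ?h y"
        using hV(2)[OF V] hW(2)[OF that] by auto
      then show ?thesis using \<rho>(3)[of "?h y" n] hW(1)[OF that] by simp
    qed
    then show ?thesis
      by (intro exI[of _ "h \<circ> \<rho> \<circ> ?h"]) (auto simp: \<rho> hV hW)
  qed
  show ?thesis
    unfolding rotation_family_def using rf 1 2 3 4 by (auto simp: rotation_family_def)
qed


section \<open>From Latin families to factorizations\<close>

context
  fixes k :: nat
begin

text \<open>Gap \<open>g\<close> joins the layers \<open>g\<close> and \<open>g + 1\<close> modulo
  \<open>k\<close>. For even \<open>k\<close> the wrap-around occurs at an odd \<open>g\<close>, so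
  only the even end is reduced.\<close>

definition even_end :: "nat \<Rightarrow> nat" where
  "even_end g = (if even g then g else Suc g mod k)"

definition odd_end :: "nat \<Rightarrow> nat" where
  "odd_end g = (if even g then Suc g else g)"

definition gap_edge :: "('j \<Rightarrow> 'v \<Rightarrow> 'v) \<Rightarrow> ('j \<Rightarrow> 'j) \<Rightarrow> 'j \<Rightarrow> nat \<Rightarrow> 'v \<Rightarrow> (nat \<times> 'v) set" where
  "gap_edge \<sigma> \<pi> j g x = {(even_end g, x), (odd_end g, \<sigma> (if Suc g = k then \<pi> j else j) x)}"

definition layered_factor ::
  "'v set \<Rightarrow> ('j \<Rightarrow> 'v \<Rightarrow> 'v) \<Rightarrow> ('j \<Rightarrow> 'j) \<Rightarrow> 'j \<Rightarrow> (nat \<times> 'v) graph" where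
  "layered_factor V \<sigma> \<pi> j =
     \<lparr>verts = {..<k} \<times> V, edges = {gap_edge \<sigma> \<pi> j g x | g x. g < k \<and> x \<in> V}\<rparr>"

end

lemma even_odd_end:
  assumes "even k" "g < k"
  shows "even (even_end k g)" "odd (odd_end g)" "even_end k g < k" "odd_end g < k"
    "{even_end k g, odd_end g} = {g, Suc g mod k}"
proof -
  have "Suc g < k" if "even g" using assms that by (metis Suc_lessI even_Suc)
  then show "even (even_end k g)" "odd (odd_end g)" "even_end k g < k" "odd_end g < k"
    "{even_end k g, odd_end g} = {g, Suc g mod k}"
    using assms by (auto simp: even_end_def odd_end_def dvd_mod)
qed

text \<open>Two distinct gaps with the same ends would force \<open>g = g + 2\<close> modulo
  \<open>k\<close>, which is impossible for \<open>k \<ge> 4\<close>.\<close>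

lemma even_odd_end_inject:
  assumes "even k" "k \<ge> 4" "g < k" "g' < k" "even_end k g = even_end k g'" "odd_end g = odd_end g'"
  shows "g = g'"
proof -
  have "g \<noteq> Suc (Suc g) mod k" if "g < k" for g
    using that assms(2) by (auto simp: mod_if split: if_splits)
  moreover have "g' = Suc g mod k \<and> g = Suc g' mod k \<or> g = g'"
    using even_odd_end(5)[OF assms(1,3)] even_odd_end(5)[OF assms(1,4)] assms(5,6)
    by (metis doubleton_eq_iff)
  ultimately show ?thesis using assms(3) by (metis mod_Suc_eq)
qed

lemma tensor_cycle_complete_edges:
  assumes "even k" "k \<ge> 4"
  shows "edges (tensor_product (cycle_graph k) (complete_graph s)) =
    {{(even_end k g, x), (odd_end g, y)} | g x y. g < k \<and> x < s \<and> y < s \<and> x \<noteq> y}" (is "?E = ?E'")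
proof (intro equalityI subsetI)
  fix e assume "e \<in> ?E"
  then obtain a x b y where e: "e = {(a, x), (b, y)}" "{a, b} \<in> edges (cycle_graph k)"
    "{x, y} \<in> edges (complete_graph s)"
    by (auto simp: tensor_product_def)
  then obtain g where g: "g < k" "{a, b} = {g, Suc g mod k}" by (auto simp: cycle_graph_def)
  have xy: "x < s" "y < s" "x \<noteq> y" using e(3) by (auto simp: complete_graph_def doubleton_eq_iff)
  have "{a, b} = {even_end k g, odd_end g}" using even_odd_end(5)[OF assms(1) g(1)] g(2) by simp
  then consider "a = even_end k g" "b = odd_end g" | "b = even_end k g" "a = odd_end g"
    by (auto simp: doubleton_eq_iff)
  then show "e \<in> ?E'"
  proof cases
    case 1
    then show ?thesis using e(1) g(1) xy by blast
  next
    case 2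
    then have "e = {(even_end k g, y), (odd_end g, x)}" using e(1) by (simp add: insert_commute)
    then show ?thesis using g(1) xy by blast
  qed
next
  fix e assume "e \<in> ?E'"
  then obtain g x y where e: "e = {(even_end k g, x), (odd_end g, y)}" "g < k" "x < s" "y < s" "x \<noteq> y"
    by blast
  have "{even_end k g, odd_end g} \<in> edges (cycle_graph k)"
    unfolding even_odd_end(5)[OF assms(1) e(2)] using e(2) by (auto simp: cycle_graph_def)
  moreover have "{x, y} \<in> edges (complete_graph s)" using e by (auto simp: complete_graph_def)
  ultimately show "e \<in> ?E" unfolding e(1) by (simp add: tensor_product_adj)
qed

text \<open>The parity of the layer tells the two endpoints apart, so the unordered edge determines
  the ordered pair.\<close>

lemma gap_edge_eq_iff:
  assumes "even k" "g < k" "g' < k"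
  shows "{(even_end k g, x), (odd_end g, y)} = {(even_end k g', x'), (odd_end g', y')} \<longleftrightarrow>
    even_end k g = even_end k g' \<and> odd_end g = odd_end g' \<and> x = x' \<and> y = y'"
  using even_odd_end(1,2)[OF assms(1,2)] even_odd_end(1,2)[OF assms(1,3)]
  by (auto simp: doubleton_eq_iff)

text \<open>Following the matchings from layer to layer, one round of \<open>k\<close> steps
  replaces the point \<open>x\<close> of layer 0 by \<open>\<rho> x\<close>. All orbits of
  \<open>\<rho>\<close> have size \<open>t\<close>, so the walk closes after exactly
  \<open>k * t\<close> steps.\<close>

lemma layered_factor_cycle_factor:
  fixes \<sigma> :: "'j \<Rightarrow> nat \<Rightarrow> nat"
  assumes rf: "rotation_family t {..<s} J \<sigma> \<pi>" and j: "j \<in> J"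
    and k: "even k" "k \<ge> 4" and t: "t > 0"
  shows "cycle_factor (k * t) (tensor_product (cycle_graph k) (complete_graph s))
           (layered_factor k {..<s} \<sigma> \<pi> j)" (is "cycle_factor _ ?G ?F")
proof (rule cycle_factorI)
  let ?V = "{..<s}"
  define \<phi> where "\<phi> g = \<sigma> (if Suc g = k then \<pi> j else j)" for g
  have \<sigma>V: "\<sigma> j x \<in> ?V" if "x \<in> ?V" for x
    using rf j that unfolding rotation_family_def bij_betw_def by blast
  have "\<pi> j \<in> J" using rf j by (auto simp: rotation_family_def bij_betw_def)
  then have \<phi>: "bij_betw (\<phi> g) ?V ?V" "x \<in> ?V \<Longrightarrow> \<phi> g x \<noteq> x" for g x
    using rf j by (auto simp: rotation_family_def \<phi>_def)
  have \<phi>V: "\<phi> g x < s" if "x < s" for g x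
    using \<phi>(1)[of g] that by (auto simp: bij_betw_def)
  have ge: "gap_edge k \<sigma> \<pi> j g x = {(even_end k g, x), (odd_end g, \<phi> g x)}" for g x
    by (simp add: gap_edge_def \<phi>_def)
  show "spanning_subgraph ?F ?G"
    unfolding spanning_subgraph_def
  proof
    show "verts ?F = verts ?G"
      by (simp add: layered_factor_def tensor_product_def cycle_graph_def complete_graph_def)
    show "edges ?F \<subseteq> edges ?G"
    proof
      fix e assume "e \<in> edges ?F"
      then obtain g x where "g < k" "x < s" "e = {(even_end k g, x), (odd_end g, \<phi> g x)}"
        by (auto simp: layered_factor_def ge)
      moreover from this have "\<phi> g x < s" "x \<noteq> \<phi> g x" using \<phi>V \<phi>(2)[of x g] by auto
      ultimately show "e \<in> edges ?G" unfolding tensor_cycle_complete_edges[OF k] by blast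
    qed
  qed
  show "k * t > 0" using k t by simp
  obtain \<rho> where \<rho>V: "\<And>x. x \<in> ?V \<Longrightarrow> \<rho> x \<in> ?V" and \<rho>: "\<And>x. x \<in> ?V \<Longrightarrow> \<sigma> (\<pi> j) (\<rho> x) = \<sigma> j x"
    and \<rho>t: "\<And>x n. x \<in> ?V \<Longrightarrow> (\<rho> ^^ n) x = x \<longleftrightarrow> t dvd n"
    using rf j unfolding rotation_family_def by metis
  have powV: "(\<rho> ^^ n) x \<in> ?V" if "x \<in> ?V" for n x
    using that \<rho>V by (induction n) auto
  have pow_le: "(\<rho> ^^ a) x = (\<rho> ^^ b) x \<longleftrightarrow> a mod t = b mod t" if "x \<in> ?V" "a \<le> b" for a b x
  proof -
    have "(\<rho> ^^ b) x = (\<rho> ^^ (b - a)) ((\<rho> ^^ a) x)"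
      using that(2) by (metis funpow_add le_add_diff_inverse2 comp_apply)
    then show ?thesis
      using \<rho>t[OF powV[OF that(1), of a], of "b - a"] mod_eq_iff_dvd_symdiff_nat[of a t b] that(2)
      by (metis mod_eq_dvd_iff_nat)
  qed
  have pow_eq: "(\<rho> ^^ a) x = (\<rho> ^^ b) x \<longleftrightarrow> a mod t = b mod t" if "x \<in> ?V" for a b x
    using pow_le[OF that, of a b] pow_le[OF that, of b a] by (metis nat_le_linear)
  have \<sigma>inj: "\<sigma> j x = \<sigma> j y \<longleftrightarrow> x = y" if "x \<in> ?V" "y \<in> ?V" for x y
    using rf j that by (auto simp: rotation_family_def bij_betw_def dest: inj_onD)
  \<comment> \<open>Within one gap the edges form a matching, so a vertex has at most one neighbour
    through it.\<close>
  have matching: "w = w'" if "g < k" "x \<in> ?V" "x' \<in> ?V" "{v, w} = {(even_end k g, x), (odd_end g, \<phi> g x)}"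
    "{v, w'} = {(even_end k g, x'), (odd_end g, \<phi> g x')}" for g x x' v w w'
  proof -
    have "even_end k g \<noteq> odd_end g" using even_odd_end(1,2)[OF k(1) that(1)] by auto
    moreover have "\<phi> g x = \<phi> g x' \<longleftrightarrow> x = x'"
      using \<phi>(1)[of g] that(2,3) by (auto simp: bij_betw_def dest: inj_onD)
    ultimately show ?thesis using that(4,5) by (auto simp: doubleton_eq_iff)
  qed
  fix v assume "v \<in> verts ?F"
  then obtain r y where v: "v = (r, y)" "r < k" "y \<in> ?V" by (auto simp: layered_factor_def)
  \<comment> \<open>The walk shall meet \<open>v\<close> at index \<open>r\<close>, in its first
    round. On odd layers it carries images under \<open>\<sigma> j\<close>, so there it must start
    from a preimage of \<open>y\<close>.\<close>
  have "y \<in> \<sigma> j ` ?V" using v(3) rf j by (auto simp: rotation_family_def bij_betw_def)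
  then have "\<exists>x\<in>?V. y = (if even r then x else \<sigma> j x)" using v(3) by auto
  then obtain x where x: "x \<in> ?V" "y = (if even r then x else \<sigma> j x)" by blast
  define z where "z n = (\<rho> ^^ (n div k)) x" for n
  define f where "f n = (n mod k, if even n then z n else \<sigma> j (z n))" for n
  have zV: "z n \<in> ?V" for n using powV[OF x(1)] by (simp add: z_def)
  have par: "even (n mod k) \<longleftrightarrow> even n" for n
    using k(1) by (simp add: dvd_mod_iff)
  have gap: "\<exists>x\<in>?V. {f n, f (Suc n)} = {(even_end k (n mod k), x), (odd_end (n mod k), \<phi> (n mod k) x)}" for n
  proof (cases "even n")
    case True
    then have ne: "Suc (n mod k) \<noteq> k" using par[of n] k(1) by (metis even_Suc)
    then have "Suc n mod k = Suc (n mod k)" "Suc n div k = n div k"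
      by (simp_all add: mod_Suc div_Suc)
    then show ?thesis
      using True ne zV[of n] par[of n]
      by (intro bexI[of _ "z n"]) (auto simp: f_def z_def even_end_def odd_end_def \<phi>_def)
  next
    case odd: False
    show ?thesis
    proof (cases "Suc (n mod k) = k")
      case True
      then have "Suc n mod k = 0" "Suc n div k = Suc (n div k)"
        by (simp_all add: mod_Suc div_Suc)
      \<comment> \<open>The last gap is read from layer 0 with \<open>\<sigma> (\<pi> j)\<close>.
        Its edge at \<open>\<sigma> j (z n)\<close> therefore leads to \<open>\<rho> (z n)\<close>,
        which starts the next round.\<close>
      then have "f (Suc n) = (0, \<rho> (z n))" using odd by (simp add: f_def z_def)
      then show ?thesis
        using odd True zV[of n] par[of n] \<rho>V \<rho>
        by (intro bexI[of _ "\<rho> (z n)"]) (auto simp: f_def even_end_def odd_end_def \<phi>_def insert_commute)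
    next
      case False
      then have "Suc n mod k = Suc (n mod k)" "Suc n div k = n div k"
        by (simp_all add: mod_Suc div_Suc)
      moreover have "Suc (n mod k) < k" using False k by (metis Suc_lessI mod_less_divisor zero_less_numeral less_le_trans)
      ultimately show ?thesis
        using odd False zV[of n] par[of n]
        by (intro bexI[of _ "z n"]) (auto simp: f_def z_def even_end_def odd_end_def \<phi>_def insert_commute)
    qed
  qed
  have kpos: "n mod k < k" for n using k by simp
  have edge: "{f n, f (Suc n)} \<in> edges ?F" for n
    using gap[of n] kpos[of n] by (auto simp: layered_factor_def ge)
  have "v \<in> range f"
    using x v by (intro image_eqI[of _ _ r]) (auto simp: f_def z_def)
  moreover have "range f \<subseteq> verts ?F"
    using zV \<sigma>V[OF zV] kpos by (auto simp: f_def layered_factor_def)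
  moreover have "f i = f i' \<longleftrightarrow> i mod (k * t) = i' mod (k * t)" for i i'
  proof -
    have "f i = f i' \<longleftrightarrow> i mod k = i' mod k \<and> z i = z i'"
      using par[of i] par[of i'] \<sigma>inj[OF zV zV, of i i'] by (auto simp: f_def)
    also have "\<dots> \<longleftrightarrow> i mod k = i' mod k \<and> (i div k) mod t = (i' div k) mod t"
      unfolding z_def pow_eq[OF x(1)] ..
    also have "\<dots> \<longleftrightarrow> i mod (k * t) = i' mod (k * t)"
    proof
      assume "i mod (k * t) = i' mod (k * t)"
      moreover from this have "i mod k = i' mod k" by (metis mod_mod_cancel dvd_triv_left)
      ultimately show "i mod k = i' mod k \<and> (i div k) mod t = (i' div k) mod t"
        using k by (simp add: mod_mult2_eq)
    qed (simp add: mod_mult2_eq)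
    finally show ?thesis .
  qed
  moreover have "{f (Suc n), w} \<in> edges ?F \<longleftrightarrow> w = f n \<or> w = f (Suc (Suc n))" for n w
  proof
    assume "w = f n \<or> w = f (Suc (Suc n))"
    then show "{f (Suc n), w} \<in> edges ?F" using edge[of n] edge[of "Suc n"] by (auto simp: insert_commute)
  next
    assume "{f (Suc n), w} \<in> edges ?F"
    then obtain g x' where g: "g < k" "x' \<in> ?V" "{f (Suc n), w} = {(even_end k g, x'), (odd_end g, \<phi> g x')}"
      by (auto simp: layered_factor_def ge)
    \<comment> \<open>Only the two gaps next to the layer of \<open>f (Suc n)\<close> contain edges
      at it, and \<open>matching\<close> leaves one neighbour in each.\<close>
    then have "Suc n mod k \<in> {even_end k g, odd_end g}" by (auto simp: f_def doubleton_eq_iff)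
    then have "g = n mod k \<or> g = Suc n mod k"
      unfolding even_odd_end(5)[OF k(1) g(1)] using g(1) by (auto simp: Suc_mod_cancel)
    then show "w = f n \<or> w = f (Suc (Suc n))"
    proof
      assume "g = n mod k"
      then show ?thesis using gap[of n] matching[OF g(1) g(2) _ g(3)] by (metis insert_commute)
    next
      assume "g = Suc n mod k"
      then show ?thesis using gap[of "Suc n"] matching[OF g(1) g(2) _ g(3)] by metis
    qed
  qed
  ultimately show "\<exists>f. v \<in> range f \<and> range f \<subseteq> verts ?F \<and>
      (\<forall>i i'. f i = f i' \<longleftrightarrow> i mod (k * t) = i' mod (k * t)) \<and>
      (\<forall>n w. {f (Suc n), w} \<in> edges ?F \<longleftrightarrow> w = f n \<or> w = f (Suc (Suc n)))"
    by (intro exI[of _ f]) auto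
qed

text \<open>In a fixed gap \<open>g\<close> the factor \<open>j\<close> uses the row
  \<open>\<iota> g j\<close>. As \<open>\<iota> g\<close> permutes \<open>J\<close>, the Latin
  property assigns each edge of the gap to exactly one factor.\<close>

lemma cycle_factorization_of_rotation_family:
  fixes \<sigma> :: "'j \<Rightarrow> nat \<Rightarrow> nat"
  assumes rf: "rotation_family t {..<s} J \<sigma> \<pi>" and k: "even k" "k \<ge> 4" and t: "t > 0" and s: "s > 0"
  shows "cycle_factorization (k * t) (tensor_product (cycle_graph k) (complete_graph s))
           (layered_factor k {..<s} \<sigma> \<pi> ` J)"
  unfolding cycle_factorization_def
proof (intro conjI ballI)
  fix F assume "F \<in> layered_factor k {..<s} \<sigma> \<pi> ` J"
  then show "cycle_factor (k * t) (tensor_product (cycle_graph k) (complete_graph s)) F"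
    using layered_factor_cycle_factor[OF rf _ k t] by blast
next
  let ?V = "{..<s}" and ?F = "layered_factor k {..<s} \<sigma> \<pi>"
  let ?G = "tensor_product (cycle_graph k) (complete_graph s)"
  define \<iota> where "\<iota> g j = (if Suc g = k then \<pi> j else j)" for g j
  have \<iota>: "bij_betw (\<iota> g) J J" for g
  proof -
    have "\<iota> g = (if Suc g = k then \<pi> else id)" by (auto simp: \<iota>_def)
    then show ?thesis using rf by (simp add: rotation_family_def)
  qed
  have ge: "gap_edge k \<sigma> \<pi> j g x = {(even_end k g, x), (odd_end g, \<sigma> (\<iota> g j) x)}" for j g x
    by (simp add: gap_edge_def \<iota>_def)
  have \<sigma>: "\<sigma> j x \<in> ?V" "\<sigma> j x \<noteq> x" if "j \<in> J" "x \<in> ?V" for j x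
    using rf that unfolding rotation_family_def bij_betw_def by blast+
  have uniq: "\<exists>!j. j \<in> J \<and> \<sigma> j x = y" if "x \<in> ?V" "y \<in> ?V" "x \<noteq> y" for x y
    using rf that unfolding rotation_family_def by blast
  show "partition_on (edges ?G) (edges ` ?F ` J)"
  proof (rule partition_onI)
    have False if "{} \<in> edges ` ?F ` J"
    proof -
      from that obtain j where "{} = edges (?F j)" by blast
      moreover have "0 < k" using k by simp
      ultimately have "gap_edge k \<sigma> \<pi> j 0 0 \<in> {}" using s by (auto simp: layered_factor_def)
      then show False by blast
    qed
    then show "{} \<notin> edges ` ?F ` J" by blast
  next
    show "\<Union> (edges ` ?F ` J) = edges ?G"
    proof
      show "\<Union> (edges ` ?F ` J) \<subseteq> edges ?G"
        using layered_factor_cycle_factor[OF rf _ k t]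
        by (auto simp: cycle_factor_def spanning_subgraph_def)
    next
      show "edges ?G \<subseteq> \<Union> (edges ` ?F ` J)"
      proof
        fix e assume "e \<in> edges ?G"
        then obtain g x y where e: "e = {(even_end k g, x), (odd_end g, y)}" "g < k" "x \<in> ?V" "y \<in> ?V" "x \<noteq> y"
          unfolding tensor_cycle_complete_edges[OF k] by auto
        obtain i where i: "i \<in> J" "\<sigma> i x = y" using uniq[OF e(3-5)] by blast
        then have "i \<in> \<iota> g ` J" using bij_betw_imp_surj_on[OF \<iota>[of g]] by simp
        then obtain j where "j \<in> J" "\<iota> g j = i" by blast
        with i have "e = gap_edge k \<sigma> \<pi> j g x" "j \<in> J" unfolding ge e(1) by simp_all
        then show "e \<in> \<Union> (edges ` ?F ` J)" using e(2,3) by (auto simp: layered_factor_def)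
      qed
    qed
  next
    fix p q assume "p \<in> edges ` ?F ` J" "q \<in> edges ` ?F ` J" and ne: "p \<noteq> q"
    then obtain i j where ij: "i \<in> J" "j \<in> J" "p = edges (?F i)" "q = edges (?F j)" by blast
    show "disjnt p q"
    proof (rule ccontr)
      assume "\<not> disjnt p q"
      then obtain e where "e \<in> p" "e \<in> q" by (auto simp: disjnt_def)
      then have "\<exists>g x. e = gap_edge k \<sigma> \<pi> i g x \<and> g < k \<and> x \<in> ?V"
        "\<exists>g x. e = gap_edge k \<sigma> \<pi> j g x \<and> g < k \<and> x \<in> ?V"
        by (simp_all add: ij layered_factor_def)
      then obtain g x g' x' where e: "e = gap_edge k \<sigma> \<pi> i g x" "g < k" "x \<in> ?V"
        "e = gap_edge k \<sigma> \<pi> j g' x'" "g' < k" "x' \<in> ?V"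
        by blast
      from e(1,4) have "{(even_end k g, x), (odd_end g, \<sigma> (\<iota> g i) x)} =
          {(even_end k g', x'), (odd_end g', \<sigma> (\<iota> g' j) x')}"
        unfolding ge by (rule trans[OF sym])
      then have ends: "even_end k g = even_end k g'" "odd_end g = odd_end g'" "x = x'"
        "\<sigma> (\<iota> g i) x = \<sigma> (\<iota> g' j) x'"
        unfolding gap_edge_eq_iff[OF k(1) e(2,5)] by auto
      then have g: "g = g'" using even_odd_end_inject[OF k e(2,5)] by blast
      have "\<iota> g i \<in> J" "\<iota> g j \<in> J" using \<iota>[of g] ij by (auto simp: bij_betw_def)
      moreover have "\<sigma> (\<iota> g i) x = \<sigma> (\<iota> g j) x" using ends g by simp
      ultimately have "\<iota> g i = \<iota> g j" using uniq[of x "\<sigma> (\<iota> g i) x"] \<sigma> e(3) by metis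
      then have "i = j" using \<iota>[of g] ij by (auto simp: bij_betw_def dest: inj_onD)
      then show False using ne ij by simp
    qed
  qed
qed


section \<open>A Latin family on \<open>\<int>\<^sub>t \<times> \<int>\<^sub>2 \<times> \<int>\<^sub>m\<close>\<close>

lemma funpow_shift:
  fixes c :: "bool \<Rightarrow> int" and T :: int
  assumes "0 \<le> x" "x < T"
  shows "((\<lambda>(x, e, y). ((x + c e) mod T, e, y)) ^^ n) (x, e, y) = ((x + int n * c e) mod T, e, y)"
  using assms by (induction n) (auto simp: mod_simps algebra_simps)

text \<open>Two consecutive steps restore the bit and add \<open>c e + c (\<not> e)\<close>; an odd
  \<open>n\<close> leaves one further step.\<close>

lemma funpow_shift_flip:
  fixes c :: "bool \<Rightarrow> int" and T :: int
  assumes "0 \<le> x" "x < T"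
  shows "((\<lambda>(x, e, y). ((x + c e) mod T, \<not> e, y)) ^^ n) (x, e, y) =
    ((x + int (n div 2) * (c e + c (\<not> e)) + (if odd n then c e else 0)) mod T, (if odd n then \<not> e else e), y)"
  using assms by (induction n) (auto simp: mod_simps algebra_simps)

lemma mod_add_eq_self:
  fixes x :: int
  assumes "0 \<le> x" "x < T"
  shows "(x + d) mod T = x \<longleftrightarrow> T dvd d"
proof -
  have "(x + d) mod T = x \<longleftrightarrow> (x + d) mod T = x mod T" using assms by simp
  also have "\<dots> \<longleftrightarrow> T dvd d" by (simp add: mod_eq_dvd_iff)
  finally show ?thesis .
qed

lemma mod_add_cancel:
  fixes x y :: int
  assumes "0 \<le> x" "x < T" "0 \<le> y" "y < T" "(x + d) mod T = (y + d) mod T"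
  shows "x = y"
proof -
  have "x mod T = y mod T" using assms(5) by (simp add: mod_eq_dvd_iff)
  then show ?thesis using assms by simp
qed

lemma funpow_shift_eq_self:
  fixes c :: "bool \<Rightarrow> int"
  assumes "0 \<le> x" "x < int t" "\<And>e. c e = 1 \<or> c e = - 1"
  shows "((\<lambda>(x, e, y). ((x + c e) mod int t, e, y)) ^^ n) (x, e, y) = (x, e, y) \<longleftrightarrow> t dvd n"
  using assms(3)[of e] by (auto simp: funpow_shift[OF assms(1,2)] mod_add_eq_self[OF assms(1,2)])

text \<open>An even \<open>n\<close> gives a total shift by \<open>n\<close> or \<open>- n\<close>.
  An odd \<open>n\<close> changes the bit, and is no multiple of the even \<open>t\<close>.\<close>

lemma funpow_shift_flip_eq_self:
  fixes c :: "bool \<Rightarrow> int"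
  assumes "0 \<le> x" "x < int t" "c True + c False = 2 \<or> c True + c False = - 2" "even t"
  shows "((\<lambda>(x, e, y). ((x + c e) mod int t, \<not> e, y)) ^^ n) (x, e, y) = (x, e, y) \<longleftrightarrow> t dvd n"
proof (cases "even n")
  case True
  have "c e + c (\<not> e) = 2 \<or> c e + c (\<not> e) = - 2" using assms(3) by (cases e) auto
  moreover have "int (n div 2) * 2 = int n" using True by auto
  ultimately have "int t dvd int (n div 2) * (c e + c (\<not> e)) \<longleftrightarrow> int t dvd int n" by auto
  with True show ?thesis
    by (simp add: funpow_shift_flip[OF assms(1,2)] mod_add_eq_self[OF assms(1,2)])
next
  case False
  then have "\<not> t dvd n" using assms(4) dvd_trans by blast
  with False show ?thesis by (simp add: funpow_shift_flip[OF assms(1,2)])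
qed

context
  fixes t m :: nat
begin

definition box :: "(int \<times> bool \<times> int) set" where
  "box = {0..<int t} \<times> UNIV \<times> {0..<int m}"

text \<open>\<open>translate\<close> adds \<open>j\<close> in the group \<open>\<int>\<^sub>t \<times> \<int>\<^sub>2 \<times> \<int>\<^sub>m\<close>, except that for even \<open>t\<close> the shifts
  by \<open>(a, True, 0)\<close> are twisted on one half of the points. Without the twist no index permutation
  \<open>\<pi>\<close> works if \<open>m = 1\<close> and \<open>4\<close> divides \<open>t\<close>: the \<open>2t - 1\<close> differences \<open>j - \<pi> j\<close> sum to zero, but elements
  of order \<open>t\<close> have odd first coordinate.\<close>

definition offset :: "int \<times> bool \<times> int \<Rightarrow> bool \<Rightarrow> int" where
  "offset = (\<lambda>(a, u, v) e.
     if even t \<and> u \<and> v = 0 \<and> e then (if a = 0 then 0 else if a = 1 then - 1 else a - 1) else a)"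

definition translate :: "int \<times> bool \<times> int \<Rightarrow> int \<times> bool \<times> int \<Rightarrow> int \<times> bool \<times> int" where
  "translate j = (\<lambda>(x, e, y).
     ((x + offset j e) mod int t, e \<noteq> fst (snd j), (y + snd (snd j)) mod int m))"

text \<open>For even \<open>t\<close> and \<open>v = 0\<close>, indices with
  \<open>a \<ge> 2\<close> are swapped in pairs \<open>2i, 2i + 1\<close>, and the other nonzero
  ones form the cycle \<open>(0, True, 0)\<close>, \<open>(1, True, 0)\<close>,
  \<open>(1, False, 0)\<close>. For odd \<open>t\<close>, the nonzero elements of \<int>_t itself
  are swapped in pairs \<open>2i - 1, 2i\<close>. Every other coset of \<int>_t is rotated by
  one.\<close>

definition partner :: "int \<times> bool \<times> int \<Rightarrow> int \<times> bool \<times> int" where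
  "partner = (\<lambda>(a, u, v).
     if even t \<and> v = 0 then
       (if a = 0 then (1, True, 0)
        else if a = 1 then (if u then (1, False, 0) else (0, True, 0))
        else (if even a then a + 1 else a - 1, u, 0))
     else if \<not> u \<and> v = 0 then (if even a then a - 1 else a + 1, u, v)
     else ((a + 1) mod int t, u, v))"

abbreviation "nonzero_box \<equiv> box - {(0, False, 0)}"

section \<open>The translations as rows of a Latin square\<close>

lemma card_box: "card box = 2 * t * m" "finite box"
  by (auto simp: box_def card_cartesian_product)

lemma inj_translate: "inj_on (translate j) box"
proof (rule inj_onI)
  fix p q assume pq: "p \<in> box" "q \<in> box" "translate j p = translate j q"
  obtain x e y x' e' y' where p: "p = (x, e, y)" "q = (x', e', y')" by (metis prod_cases3)
  then have "e = e'" using pq by (auto simp: translate_def)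
  then show "p = q" using pq p by (auto simp: translate_def box_def dest: mod_add_cancel)
qed

lemma translate_box:
  assumes "t > 0" "m > 0" "x \<in> box" shows "translate j x \<in> box"
  using assms by (auto simp: translate_def box_def)

lemma bij_translate:
  assumes "t > 0" "m > 0" shows "bij_betw (translate j) box box"
  using assms translate_box inj_translate card_box(2)
  by (simp add: bij_betw_def endo_inj_surj image_subsetI)

lemma translate_eq_iff:
  assumes "t \<ge> 3" "m > 0" "(a, u, v) \<in> box" "(x, e, y) \<in> box"  "(x', e', y') \<in> box"
  shows "translate (a, u, v) (x, e, y) = (x', e', y') \<longleftrightarrow>
    offset (a, u, v) e mod int t = (x' - x) mod int t \<and> (u \<longleftrightarrow> e \<noteq> e') \<and> v = (y' - y) mod int m"
proof -
  have *: "(p + d) mod T = q \<longleftrightarrow> d mod T = (q - p) mod T" if "0 \<le> q" "q < T" for p q d T :: int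
  proof -
    have "(p + d) mod T = q \<longleftrightarrow> (p + d) mod T = q mod T" using that by simp
    also have "\<dots> \<longleftrightarrow> d mod T = (q - p) mod T" by (simp add: mod_eq_dvd_iff algebra_simps)
    finally show ?thesis .
  qed
  have "v mod int m = v" using assms(3) by (simp add: box_def)
  then show ?thesis using assms(5) by (auto simp: translate_def box_def *)
qed

text \<open>The twist sends 0 to 0, 1 to \<open>t - 1\<close> and every other \<open>a\<close> to
  \<open>a - 1\<close>, which is still a permutation of the residues; hence the Latin property is
  preserved.\<close>

lemma ex1_offset:
  assumes t: "t \<ge> 3" and d: "0 \<le> d" "d < int t"
  shows "\<exists>!a. 0 \<le> a \<and> a < int t \<and> offset (a, u, v) e mod int t = d"
proof (cases "even t \<and> u \<and> v = 0 \<and> e")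
  case True
  then have off: "offset (a, u, v) e mod int t =
    (if a = 0 then 0 else if a = 1 then int t - 1 else a - 1)" if "0 \<le> a" "a < int t" for a
    using that t by (auto simp: offset_def zmod_minus1)
  show ?thesis
  proof (rule ex1I)
    let ?a = "if d = 0 then 0 else if d = int t - 1 then 1 else d + 1"
    show "0 \<le> ?a \<and> ?a < int t \<and> offset (?a, u, v) e mod int t = d"
      using d t off[of ?a] by (auto split: if_splits)
    show "a = ?a" if "0 \<le> a \<and> a < int t \<and> offset (a, u, v) e mod int t = d" for a
      using that d t off[of a] by (auto split: if_splits)
  qed
next
  case False
  then show ?thesis using d by (intro ex1I[of _ d]) (auto simp: offset_def)
qed

text \<open>The difference of \<open>q\<close> and \<open>p\<close> forces the last two coordinates
  of the index, and \<open>ex1_offset\<close> the first. The index is nonzero because zero fixes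
  \<open>p\<close>.\<close>

lemma ex1_translate:
  assumes t: "t \<ge> 3" and m: "m > 0" and p: "p \<in> box" and q: "q \<in> box" and "p \<noteq> q"
  shows "\<exists>!j. j \<in> nonzero_box \<and> translate j p = q"
proof -
  obtain x e y x' e' y' where pq: "p = (x, e, y)" "q = (x', e', y')" by (metis prod_cases3)
  let ?u = "e \<noteq> e'" and ?v = "(y' - y) mod int m" and ?d = "(x' - x) mod int t"
  have iff: "translate (a, u, v) p = q \<longleftrightarrow> offset (a, u, v) e mod int t = ?d \<and> u = ?u \<and> v = ?v"
    if "(a, u, v) \<in> box" for a u v
    using translate_eq_iff[OF t m that] p q unfolding pq by auto
  have "\<exists>!a. 0 \<le> a \<and> a < int t \<and> offset (a, ?u, ?v) e mod int t = ?d"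
    using t by (intro ex1_offset) auto
  then obtain a where a: "0 \<le> a" "a < int t" "offset (a, ?u, ?v) e mod int t = ?d"
    and uniq: "\<And>b. 0 \<le> b \<and> b < int t \<and> offset (b, ?u, ?v) e mod int t = ?d \<Longrightarrow> b = a"
    by blast
  have box: "(a, ?u, ?v) \<in> box" using a m by (simp add: box_def)
  have tr: "translate (a, ?u, ?v) p = q" using iff[OF box] a by simp
  moreover have "translate (0, False, 0) p = p"
    using p by (auto simp: pq translate_def offset_def box_def)
  ultimately have "(a, ?u, ?v) \<noteq> (0, False, 0)" using \<open>p \<noteq> q\<close> by metis
  with box tr have "(a, ?u, ?v) \<in> nonzero_box \<and> translate (a, ?u, ?v) p = q" by blast
  moreover have "j = (a, ?u, ?v)" if "j \<in> nonzero_box \<and> translate j p = q" for j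
  proof -
    obtain b u v where j: "j = (b, u, v)" by (metis prod_cases3)
    then have "(b, u, v) \<in> box" "translate (b, u, v) p = q" using that by auto
    then show ?thesis using iff[of b u v] uniq[of b] j by (auto simp: box_def)
  qed
  ultimately show ?thesis by blast
qed

lemma translate_neq:
  assumes t: "t \<ge> 3" and m: "m > 0" and j: "j \<in> nonzero_box" and p: "p \<in> box"
  shows "translate j p \<noteq> p"
proof -
  obtain x e y where p': "p = (x, e, y)" by (metis prod_cases3)
  obtain a u v where j': "j = (a, u, v)" by (metis prod_cases3)
  have "(a, u, v) \<in> box" using j j' by simp
  then show ?thesis
    using translate_eq_iff[OF t m _ p[unfolded p'] p[unfolded p']] j unfolding p' j'
    by (auto simp: offset_def box_def)
qed

section \<open>The index permutation and its rotations\<close>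

lemma partner_nonzero_box:
  assumes t: "t \<ge> 3" and m: "m > 0" and j: "j \<in> nonzero_box"
  shows "partner j \<in> nonzero_box"
proof -
  obtain a u v where j': "j = (a, u, v)" by (metis prod_cases3)
  \<comment> \<open>By parity \<open>a\<close> is not \<open>t - 1\<close>, so no pair leaves the
    range.\<close>
  have "a + 1 < int t" if "even a \<longleftrightarrow> even t" "a < int t"
    using that by (cases "a + 1 = int t") presburger+
  then show ?thesis
    using j t m unfolding j' by (auto simp: partner_def box_def)
qed

lemma inj_partner: "inj_on partner nonzero_box"
proof (rule inj_onI)
  fix i j assume ij: "i \<in> nonzero_box" "j \<in> nonzero_box" "partner i = partner j"
  obtain a u v b u' v' where "i = (a, u, v)" "j = (b, u', v')" by (metis prod_cases3)
  then show "i = j"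
    using ij by (auto simp: partner_def box_def split: if_splits dest: mod_add_cancel) 
qed

lemma bij_partner:
  assumes "t \<ge> 3" "m > 0" shows "bij_betw partner nonzero_box nonzero_box"
  unfolding bij_betw_def
proof
  show "partner ` nonzero_box = nonzero_box"
    using partner_nonzero_box[OF assms] inj_partner card_box(2)
    by (intro endo_inj_surj finite_Diff image_subsetI)
qed (fact inj_partner)

lemma translate_shift:
  assumes "snd j' = snd j" "\<And>e. (c e + offset j' e) mod int t = offset j e mod int t"
  shows "translate j' ((\<lambda>(x, e, y). ((x + c e) mod int t, e, y)) p) = translate j p"
proof -
  obtain x e y where p: "p = (x, e, y)" by (metis prod_cases3)
  have "((x + c e) mod int t + offset j' e) mod int t = (x + (c e + offset j' e) mod int t) mod int t"
    by (simp add: mod_simps add.assoc)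
  then show ?thesis unfolding assms(2) by (simp add: p translate_def assms(1) mod_simps)
qed

text \<open>If \<open>partner\<close> keeps the bit \<open>u\<close>, then \<rho> shifts each half
  by 1 or -1. If it changes \<open>u\<close>, then \<rho> also flips the bit, and two steps add 2 or
  -2, which gives order \<open>t\<close> for even \<open>t\<close>.\<close>

lemma rotation_partner:
  assumes t: "t \<ge> 3" and m: "m > 0" and j: "j \<in> nonzero_box"
  shows "\<exists>\<rho>. \<forall>p\<in>box. \<rho> p \<in> box \<and> translate (partner j) (\<rho> p) = translate j p \<and>
    (\<forall>n. (\<rho> ^^ n) p = p \<longleftrightarrow> t dvd n)"
proof -
  obtain a u v where j': "j = (a, u, v)" by (metis prod_cases3)
  let ?shift = "\<lambda>c (x::int, e::bool, y::int). ((x + c e) mod int t, e, y)"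
  let ?flip = "\<lambda>c (x::int, e::bool, y::int). ((x + c e) mod int t, \<not> e, y)"
  have shift: ?thesis if c: "\<And>e. c e = 1 \<or> c e = - 1"
    and *: "\<And>p. p \<in> box \<Longrightarrow> translate (partner j) (?shift c p) = translate j p" for c
    using c * t by (intro exI[of _ "?shift c"]) (auto simp: funpow_shift_eq_self box_def)
  have flip: ?thesis if c: "c True + c False = 2 \<or> c True + c False = - 2" "even t"
    and *: "\<And>p. p \<in> box \<Longrightarrow> translate (partner j) (?flip c p) = translate j p" for c
    using c * t by (intro exI[of _ "?flip c"]) (auto simp: funpow_shift_flip_eq_self box_def)
  \<comment> \<open>\<open>A\<close>, \<open>B\<close> and \<open>C\<close> are the three-cycle,
    \<open>D\<close> and \<open>E\<close> the swapped pairs, \<open>O\<close> the rotated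
    cosets.\<close>
  consider (A) "even t" "j = (0, True, 0)" | (B) "even t" "j = (1, True, 0)"
    | (C) "even t" "j = (1, False, 0)" | (D) "even t" "v = 0" "a \<ge> 2"
    | (E) "odd t" "\<not> u" "v = 0" | (O) "u \<and> odd t \<or> v \<noteq> 0"
    using j unfolding j' by (fastforce simp: box_def)
  then show ?thesis
  proof cases
    case A
    then show ?thesis
      by (intro shift[of "\<lambda>e. if e then 1 else - 1"])
        (auto simp: partner_def translate_def offset_def box_def mod_simps)
  next
    case B
    then show ?thesis
      \<comment> \<open>The partner has offset 1 on both halves, so \<open>c e\<close> is the
        twisted offset (-1 or 1) minus 1.\<close>
      by (intro flip[of "\<lambda>e. if e then - 2 else 0"])
        (auto simp: partner_def translate_def offset_def box_def mod_simps)
  next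
    case C
    then show ?thesis
      by (intro flip[of "\<lambda>e. 1"])
        (auto simp: partner_def translate_def offset_def box_def mod_simps)
  next
    case D
    then show ?thesis
      by (intro shift[of "\<lambda>e. if even a then - 1 else 1"] translate_shift)
        (auto simp: j' partner_def offset_def mod_simps)
  next
    case E
    then show ?thesis
      by (intro shift[of "\<lambda>e. if even a then 1 else - 1"] translate_shift)
        (auto simp: j' partner_def offset_def mod_simps)
  next
    case O
    then have "partner j = ((a + 1) mod int t, u, v)" "offset j e = a"
      "offset ((a + 1) mod int t, u, v) e = (a + 1) mod int t" for e
      by (auto simp: j' partner_def offset_def)
    moreover have "(- 1 + (a + 1) mod int t) mod int t = a mod int t"
      using mod_add_right_eq[of "- 1" "a + 1" "int t"] by simp
    ultimately show ?thesis
      by (intro shift[of "\<lambda>e. - 1"] translate_shift) (simp_all add: j')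
  qed
qed

lemma rotation_family_box:
  assumes "t \<ge> 3" "m > 0"
  shows "rotation_family t box nonzero_box translate partner"
  unfolding rotation_family_def
  using assms
  by (intro conjI ballI impI bij_partner bij_translate translate_neq ex1_translate
      rotation_partner) auto

end

theorem theorem3p7:
  fixes k t s :: nat
  assumes "even k" and "k \<ge> 4" and "t \<ge> 3" and "s > 0" and "[s = 0] (mod (2 * t))"
  shows "\<exists>\<F>. cycle_factorization (k * t) (tensor_product (cycle_graph k) (complete_graph s)) \<F>"
proof -
  from assms(5) obtain m where s: "s = 2 * t * m" by (auto simp: cong_0_iff elim: dvdE)
  then have m: "m > 0" using assms(4) by (cases m) auto
  \<comment> \<open>Any bijection serves, since \<open>rotation_family\<close> does not refer to the
    labels of the points.\<close>
  obtain h where "bij_betw h (box t m) {..<s}"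
    using ex_bij_betw_finite_nat[OF card_box(2)] card_box(1) s by (metis atLeast0LessThan)
  from rotation_family_transfer[OF rotation_family_box[OF assms(3) m] this]
  show ?thesis
    using cycle_factorization_of_rotation_family assms(1-4) by (metis gr0I not_numeral_le_zero)
qed

end
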